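(* Let $n,r$ be positive integers, $d=\gcd(r,n)$, $G_r=2^r+1$, and let $e$ be the least positive residue of the inverse of $\frac rd$ modulo $\frac nd$. Let $a\in\{1,\dots,2^n-2\}$ with binary expansion $a=\sum_{m=0}^{n-1}\alpha_m2^m$, and define the $d\times\frac nd$ matrix $(a_{i,j})_{0\le i\le d-1,\,0\le j\le n/d-1}$ by $a_{i,j}=\alpha_{(i-jr)\bmod n}$ (so $a\equiv\sum_{i,j}a_{i,j}2^{i-jr}\pmod{2^n-1}$). The following are equivalent: (a) $a$ is the inverse of $G_r$ modulo $2^n-1$; (b) there exists a $d\times\frac nd$ matrix $(c_{i,j})$ with entries in $\{0,1\}$ such that $$2c_{0,0}-c_{d-1,e}+1=a_{0,1}+a_{0,0},$$ $$2c_{0,j}-c_{d-1,j+e}=a_{0,j+1}+a_{0,j}\quad\text{for all } j\in\{1,\dots,\tfrac nd-1\},$$ $$2c_{i,j}-c_{i-1,j}=a_{i,j+1}+a_{i,j}\quad\text{for all } i\in\{1,\dots,d-1\},\ j\in\{0,\dots,\tfrac nd-1\},$$ where column indices are taken modulo $\frac nd$. Moreover, the matrix $(c_{i,j})$ in (b) is unique.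
   Context: Powers $2^{m}$ with arbitrary integer $m$ are understood modulo $2^n-1$, i.e. $2^m=2^{m\bmod n}$. *)

theory Defs
  imports "HOL-Number_Theory.Cong" "Jordan_Normal_Form.Matrix"
begin

definition G :: "nat \<Rightarrow> int" where
  "G r = 2 ^ r + 1"

text \<open>Powers of two with an arbitrary integer exponent, read modulo \<open>2 ^ n - 1\<close>.\<close>

definition pow2 :: "nat \<Rightarrow> int \<Rightarrow> int" where
  "pow2 n m = 2 ^ nat (m mod int n)"

text \<open>The residue is taken in \<open>{1..n/d}\<close> with \<open>d = gcd r n\<close>; in particular it
  is 1 (not 0) when the modulus \<open>n/d\<close> is 1.\<close>

definition inv_exp :: "nat \<Rightarrow> nat \<Rightarrow> nat" where
  "inv_exp n r = (LEAST e. 0 < e \<and> [(r div gcd r n) * e = 1] (mod (n div gcd r n)))"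

definition digit_mat :: "nat \<Rightarrow> nat \<Rightarrow> (nat \<Rightarrow> int) \<Rightarrow> int mat" where
  "digit_mat n r \<alpha> =
     mat (gcd r n) (n div gcd r n) (\<lambda>(i, j). \<alpha> (nat ((int i - int j * int r) mod int n)))"

definition carry_mat :: "nat \<Rightarrow> nat \<Rightarrow> int mat \<Rightarrow> int mat \<Rightarrow> bool" where
  "carry_mat n r A C \<longleftrightarrow>
    (let d = gcd r n; k = n div d; e = inv_exp n r;
         a = (\<lambda>i j. A $$ (i, j mod k)); c = (\<lambda>i j. C $$ (i, j mod k))
     in C \<in> carrier_mat d k \<and>
        (\<forall>i<d. \<forall>j<k. c i j \<in> {0, 1}) \<and>
        2 * c 0 0 - c (d - 1) e + 1 = a 0 1 + a 0 0 \<and>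
        (\<forall>j\<in>{1..<k}. 2 * c 0 j - c (d - 1) (j + e) = a 0 (j + 1) + a 0 j) \<and>
        (\<forall>i\<in>{1..<d}. \<forall>j\<in>{0..<k}. 2 * c i j - c (i - 1) j = a i (j + 1) + a i j))"

end

theory Submission
  imports Defs
begin

text \<open>
  The map \<open>(i, j) \<mapsto> i - j r\<close> is a bijection from the index set of the matrices onto the residues
  modulo \<open>n\<close>, so \<^const>\<open>digit_mat\<close> identifies matrices with \<open>n\<close>-periodic sequences. Going one column
  to the right is the shift by \<open>-r\<close>, and because \<open>e r \<equiv> d\<close> modulo \<open>n\<close>, going one row up (and from row 0 to
  row \<open>d - 1\<close> while adding \<open>e\<close> to the column) is the shift by \<open>-1\<close>. The equations in (b) thus say that
  \<open>2 \<gamma>\<^sub>m - \<gamma>\<^sub>m\<^sub>-\<^sub>1 + [m = 0] = \<alpha>\<^sub>m\<^sub>-\<^sub>r + \<alpha>\<^sub>m\<close> around the cycle, i.e. that \<open>\<gamma>\<close> is the sequence of carries of an addition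
  with carry of \<open>a\<close> and its rotation by \<open>r\<close>, with result 1. Such a sequence forces \<open>a G\<^sub>r \<equiv> 1\<close>.
  Conversely, if \<open>a G\<^sub>r \<equiv> 1\<close>, then the sum of \<open>a\<close> and its rotation is exactly \<open>2\<^sup>n\<close>, by size, and its
  carries are the required sequence. The difference \<open>\<delta>\<close> of two solutions satisfies
  \<open>\<delta>\<^sub>m\<^sub>-\<^sub>1 = 2 \<delta>\<^sub>m\<close>, so it vanishes by parity.
\<close>

section \<open>Periodic sequences on the integers\<close>

text \<open>Integer arguments let shifts by \<open>-r\<close> and \<open>-1\<close> be written
  without reduction. For positive \<open>n\<close>, only the values of \<open>f\<close> below
  \<open>n\<close> matter.\<close>

definition cyc :: "nat \<Rightarrow> (nat \<Rightarrow> 'a) \<Rightarrow> int \<Rightarrow> 'a" where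
  "cyc n f x = f (nat (x mod int n))"

text \<open>With \<open>cyc n \<gamma> (x - 1)\<close> moved to the right, this is one step of
  binary addition: that term is the carry into position \<open>x\<close>,
  \<open>cyc n \<gamma> x\<close> the carry out of it, and the \<open>if\<close> term the digit of
  the result.\<close>

definition cyclic_carry :: "nat \<Rightarrow> nat \<Rightarrow> (nat \<Rightarrow> int) \<Rightarrow> (nat \<Rightarrow> int) \<Rightarrow> bool" where
  "cyclic_carry n r \<alpha> \<gamma> \<longleftrightarrow>
    (\<forall>x. cyc n \<gamma> x \<in> {0, 1} \<and>
      2 * cyc n \<gamma> x - cyc n \<gamma> (x - 1) + (if int n dvd x then 1 else 0) = cyc n \<alpha> (x - int r) + cyc n \<alpha> x)"

lemma cyc_cong: "[x = y] (mod int n) \<Longrightarrow> cyc n f x = cyc n f y"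
  by (simp add: cyc_def cong_def)

lemma cyc_of_nat: "m < n \<Longrightarrow> cyc n f (int m) = f m"
  by (simp add: cyc_def)

lemma cyc_in:
  assumes "0 < n" "\<And>m. m < n \<Longrightarrow> f m \<in> S"
  shows "cyc n f x \<in> S"
proof -
  have "nat (x mod int n) < n"
    using assms(1) by (simp add: nat_less_iff)
  then show ?thesis
    using assms(2) by (simp add: cyc_def)
qed

section \<open>Matrix indices and residues modulo \<open>n\<close>\<close>

text \<open>Multiplying the congruence that defines \<open>inv_exp\<close> by \<open>gcd r n\<close>
  also multiplies its modulus, from \<open>n div gcd r n\<close> to \<open>n\<close>.\<close>

lemma inv_exp_cong:
  assumes "0 < n" "0 < r"
  shows "[int (inv_exp n r) * int r = int (gcd r n)] (mod int n)"
proof -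
  let ?d = "gcd r n"
  let ?P = "\<lambda>e. 0 < e \<and> [(r div ?d) * e = 1] (mod (n div ?d))"
  have cop: "coprime (r div ?d) (n div ?d)"
    using assms by (simp add: div_gcd_coprime)
  then obtain x where x: "[(r div ?d) * x = 1] (mod (n div ?d))"
    using cong_solve_coprime_nat by auto
  have k: "0 < n div ?d"
    using assms by (simp add: div_greater_zero_iff)
  \<comment> \<open>\<open>x\<close> may be 0 when the modulus is 1; adding the modulus makes the
    witness positive.\<close>
  have "?P (x + n div ?d)"
    using x k by (simp add: cong_def distrib_left)
  then have "?P (inv_exp n r)"
    unfolding inv_exp_def by (rule LeastI)
  then have "[?d * ((r div ?d) * inv_exp n r) = ?d * 1] (mod (?d * (n div ?d)))"
    by (simp only: cong_def mult_mod_right[symmetric])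
  moreover have "?d * ((r div ?d) * inv_exp n r) = inv_exp n r * r"
    by (metis dvd_mult_div_cancel gcd_dvd1 mult.assoc mult.commute)
  ultimately have "[inv_exp n r * r = ?d] (mod n)"
    by simp
  then show ?thesis
    by (simp flip: of_nat_mult add: cong_int_iff)
qed

text \<open>Both sets have \<open>n\<close> elements, so injectivity suffices. Modulo
  \<open>gcd r n\<close> the term \<open>j * r\<close> vanishes, which determines \<open>i\<close>;
  then \<open>j\<close> is recovered by cancelling first the gcd and then the unit
  \<open>r div gcd r n\<close>.\<close>

lemma bij_betw_index:
  assumes "0 < n" "0 < r"
  shows "bij_betw (\<lambda>(i, j). nat ((int i - int j * int r) mod int n))
    ({..<gcd r n} \<times> {..<n div gcd r n}) {..<n}"
proof -
  let ?d = "gcd r n" and ?k = "n div gcd r n"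
  let ?f = "\<lambda>(i, j). nat ((int i - int j * int r) mod int n)"
  have n: "n = ?d * ?k" by simp
  have inj: "inj_on ?f ({..<?d} \<times> {..<?k})"
  proof (rule inj_onI, clarsimp)
    fix i j i' j'
    assume b: "i < ?d" "j < ?k" "i' < ?d" "j' < ?k"
      and eq: "nat ((int i - int j * int r) mod int n) = nat ((int i' - int j' * int r) mod int n)"
    have c: "[int i - int j * int r = int i' - int j' * int r] (mod int n)"
      using eq assms by (simp add: cong_def nat_eq_iff)
    have dr: "[int r = 0] (mod int ?d)" by (simp add: cong_0_iff)
    have "[int i - int j * int r = int i' - int j' * int r] (mod int ?d)"
      using c by (rule cong_dvd_modulus) simp
    moreover have "[int i - int j * int r = int i - int j * 0] (mod int ?d)"
      "[int i' - int j' * int r = int i' - int j' * 0] (mod int ?d)"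
      using dr by (intro cong_diff cong_mult cong_refl; simp)+
    ultimately have "[int i = int i'] (mod int ?d)"
      by (simp add: cong_def)
    then have ii: "i = i'"
      using b by (simp add: cong_def)
    have "[int i - (int i - int j * int r) = int i' - (int i' - int j' * int r)] (mod int n)"
      using ii by (intro cong_diff c) auto
    then have "[j * r = j' * r] (mod n)"
      by (simp flip: of_nat_mult add: cong_int_iff)
    moreover have "x * r = x * (r div ?d) * ?d" for x
      by (simp add: mult.assoc)
    moreover have "n = ?k * ?d"
      by simp
    ultimately have "[j * (r div ?d) * ?d = j' * (r div ?d) * ?d] (mod (?k * ?d))"
      by metis
    then have "[j * (r div ?d) = j' * (r div ?d)] (mod ?k)"
      using assms(1) by (simp only: cong_def mod_mult_mult2) auto
    moreover have "coprime (r div ?d) ?k"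
      using assms by (simp add: div_gcd_coprime)
    ultimately have "[j = j'] (mod ?k)"
      by (simp add: cong_mult_rcancel_nat)
    then have "j = j'"
      using b by (simp add: cong_def)
    with ii show "i = i' \<and> j = j'" by simp
  qed
  moreover have "?f ` ({..<?d} \<times> {..<?k}) = {..<n}"
  proof (rule card_subset_eq)
    show "?f ` ({..<?d} \<times> {..<?k}) \<subseteq> {..<n}"
      using assms by (auto simp: nat_less_iff)
    show "card (?f ` ({..<?d} \<times> {..<?k})) = card {..<n}"
      using card_image[OF inj] by simp
  qed simp
  ultimately show ?thesis
    by (simp add: bij_betw_def)
qed

lemma ex_index:
  assumes "0 < n" "0 < r"
  obtains i j where "i < gcd r n" "j < n div gcd r n" "[x = int i - int j * int r] (mod int n)"
proof -
  have "nat (x mod int n) \<in> {..<n}"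
    using assms by (simp add: nat_less_iff)
  then obtain i j where "i < gcd r n" "j < n div gcd r n"
    "nat (x mod int n) = nat ((int i - int j * int r) mod int n)"
    unfolding bij_betw_imp_surj_on[OF bij_betw_index[OF assms], symmetric] by auto
  then show ?thesis
    using assms that by (simp add: cong_def nat_eq_iff)
qed

text \<open>Reducing the column index is harmless because \<open>n\<close> divides
  \<open>(n div gcd r n) * r\<close>.\<close>

lemma digit_mat_index:
  assumes "0 < n" "i < gcd r n"
  shows "digit_mat n r f $$ (i, j mod (n div gcd r n)) = cyc n f (int i - int j * int r)"
proof -
  let ?d = "gcd r n" and ?k = "n div gcd r n"
  have k: "0 < ?k"
    using assms by (simp add: div_greater_zero_iff)
  have "[j mod ?k = j] (mod ?k)" by simp
  then have "[(j mod ?k) * ?d = j * ?d] (mod (?k * ?d))"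
    by (simp only: cong_def mod_mult_mult2)
  moreover have "?k * ?d = n"
    by simp
  ultimately have "[(j mod ?k) * ?d * (r div ?d) = j * ?d * (r div ?d)] (mod n)"
    by (metis cong_scalar_right)
  then have "[(j mod ?k) * r = j * r] (mod n)"
    by (simp add: mult.assoc)
  then have "[int (j mod ?k) * int r = int j * int r] (mod int n)"
    by (simp flip: of_nat_mult add: cong_int_iff)
  then have "cyc n f (int i - int (j mod ?k) * int r) = cyc n f (int i - int j * int r)"
    by (intro cyc_cong cong_diff cong_refl)
  then show ?thesis
    using assms(2) k by (simp add: digit_mat_def cyc_def)
qed

text \<open>The entries of \<open>C\<close> are transported along the inverse of the index
  bijection, so that any candidate carry matrix can be treated as a sequence.\<close>

lemma ex_digit_mat:
  assumes "0 < n" "0 < r" "C \<in> carrier_mat (gcd r n) (n div gcd r n)"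
  obtains f where "C = digit_mat n r f"
proof -
  let ?g = "\<lambda>(i, j). nat ((int i - int j * int r) mod int n)"
  let ?I = "{..<gcd r n} \<times> {..<n div gcd r n}"
  have inj: "inj_on ?g ?I"
    using bij_betw_index[OF assms(1,2)] by (rule bij_betw_imp_inj_on)
  have "C = digit_mat n r (\<lambda>m. C $$ the_inv_into ?I ?g m)"
    using assms(3) the_inv_into_f_f[OF inj] by (intro eq_matI) (auto simp: digit_mat_def)
  then show ?thesis by (rule that)
qed

section \<open>Matrix equations as equations on the cycle\<close>

text \<open>Each equation of \<open>carry_mat\<close> is the cyclic equation \<open>E\<close> at the
  point \<open>p i j\<close>, and these points represent all residues modulo
  \<open>n\<close>.\<close>

lemma carry_mat_iff:
  assumes "0 < n" "0 < r"
  shows "carry_mat n r (digit_mat n r \<alpha>) (digit_mat n r \<gamma>) \<longleftrightarrow> cyclic_carry n r \<alpha> \<gamma>"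
    (is "?L \<longleftrightarrow> ?R")
proof -
  define d where "d = gcd r n"
  define k where "k = n div d"
  define e where "e = inv_exp n r"
  define p where "p i j = int i - int j * int r" for i j
  define E where "E x \<longleftrightarrow> 2 * cyc n \<gamma> x - cyc n \<gamma> (x - 1) + (if int n dvd x then 1 else 0) =
    cyc n \<alpha> (x - int r) + cyc n \<alpha> x" for x
  have d: "0 < d" and k: "0 < k"
    using assms by (simp_all add: d_def k_def div_greater_zero_iff)
  have ix: "digit_mat n r f $$ (i, j mod k) = cyc n f (p i j)" if "i < d" for f :: "nat \<Rightarrow> int" and i j
    using digit_mat_index[OF assms(1)] that unfolding d_def k_def p_def by blast
  have next_col: "p i (j + 1) = p i j - int r" for i j
    by (simp add: p_def algebra_simps)
  have prev_row: "p (i - 1) j = p i j - 1" if "1 \<le> i" for i j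
    using that by (simp add: p_def of_nat_diff)
  \<comment> \<open>Going up from row 0 lands in row \<open>d - 1\<close>; the surplus
    \<open>d\<close> is offset by the \<open>e\<close> extra columns, since \<open>e * r\<close> is
    congruent to \<open>d\<close>.\<close>
  have wrap: "cyc n \<gamma> (p (d - 1) (j + e)) = cyc n \<gamma> (p 0 j - 1)" for j
  proof (rule cyc_cong)
    have "[int d - int e * int r = int d - int d] (mod int n)"
      using inv_exp_cong[OF assms] unfolding d_def e_def by (intro cong_diff cong_refl)
    then have "[(int d - int e * int r) + (- int j * int r - 1) = 0 + (- int j * int r - 1)] (mod int n)"
      by (intro cong_add) simp_all
    then show "[p (d - 1) (j + e) = p 0 j - 1] (mod int n)"
      using d by (simp add: p_def of_nat_diff algebra_simps)
  qed
  \<comment> \<open>By injectivity, position 0 of the cycle is met only at the entry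
    \<open>(0, 0)\<close>, so the extra 1 occurs in a single equation.\<close>
  have dvd: "int n dvd p i j \<longleftrightarrow> i = 0 \<and> j = 0" if "i < d" "j < k" for i j
  proof
    assume "int n dvd p i j"
    then have "nat (p i j mod int n) = nat (p 0 0 mod int n)"
      by (simp add: p_def)
    then have "(i, j) = (0, 0)"
      using that d k unfolding d_def k_def p_def
      by (intro inj_onD[OF bij_betw_imp_inj_on[OF bij_betw_index[OF assms]]]) auto
    then show "i = 0 \<and> j = 0" by simp
  qed (simp add: p_def)
  have cong_E: "E x \<longleftrightarrow> E y" if "[x = y] (mod int n)" for x y
  proof -
    have "cyc n \<gamma> (x - 1) = cyc n \<gamma> (y - 1)" "cyc n \<alpha> (x - int r) = cyc n \<alpha> (y - int r)"
      by (intro cyc_cong cong_diff that cong_refl)+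
    moreover have "int n dvd x \<longleftrightarrow> int n dvd y"
      using that by (simp add: cong_def dvd_eq_mod_eq_0)
    ultimately show ?thesis
      using cyc_cong[OF that, of \<gamma>] cyc_cong[OF that, of \<alpha>] by (simp add: E_def)
  qed
  have index: "\<exists>i<d. \<exists>j<k. [x = p i j] (mod int n)" for x
    unfolding d_def k_def p_def by (rule ex_index[OF assms, of x]) blast
  have E_iff: "(\<forall>x. E x) \<longleftrightarrow> (\<forall>i<d. \<forall>j<k. E (p i j))"
    using index cong_E by blast
  have bin_iff: "(\<forall>x. cyc n \<gamma> x \<in> {0, 1}) \<longleftrightarrow> (\<forall>i<d. \<forall>j<k. cyc n \<gamma> (p i j) \<in> {0, 1})"
    using index cyc_cong[of _ _ n \<gamma>] by metis
  have carrier: "digit_mat n r \<gamma> \<in> carrier_mat d k"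
    by (simp add: digit_mat_def d_def k_def)
  have E00: "E (p 0 0) \<longleftrightarrow>
    2 * cyc n \<gamma> (p 0 0) - cyc n \<gamma> (p (d - 1) e) + 1 = cyc n \<alpha> (p 0 1) + cyc n \<alpha> (p 0 0)"
    using wrap[of 0] next_col[of 0 0] dvd[OF d k] by (simp add: E_def)
  have E0: "E (p 0 j) \<longleftrightarrow>
    2 * cyc n \<gamma> (p 0 j) - cyc n \<gamma> (p (d - 1) (j + e)) = cyc n \<alpha> (p 0 (j + 1)) + cyc n \<alpha> (p 0 j)"
    if "j \<in> {1..<k}" for j
    using that wrap[of j] next_col[of 0 j] dvd[OF d, of j] by (simp add: E_def)
  have E1: "E (p i j) \<longleftrightarrow>
    2 * cyc n \<gamma> (p i j) - cyc n \<gamma> (p (i - 1) j) = cyc n \<alpha> (p i (j + 1)) + cyc n \<alpha> (p i j)"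
    if "i \<in> {1..<d}" "j \<in> {0..<k}" for i j
    using that prev_row[of i j] next_col[of i j] dvd[of i j] by (simp add: E_def)
  have split: "(\<forall>i<d. \<forall>j<k. E (p i j)) \<longleftrightarrow>
    E (p 0 0) \<and> (\<forall>j\<in>{1..<k}. E (p 0 j)) \<and> (\<forall>i\<in>{1..<d}. \<forall>j\<in>{0..<k}. E (p i j))"
  proof (intro iffI allI impI)
    assume L: "\<forall>i<d. \<forall>j<k. E (p i j)"
    show "E (p 0 0) \<and> (\<forall>j\<in>{1..<k}. E (p 0 j)) \<and> (\<forall>i\<in>{1..<d}. \<forall>j\<in>{0..<k}. E (p i j))"
    proof (intro conjI ballI)
      show "E (p 0 0)" using L d k by blast
      show "E (p 0 j)" if "j \<in> {1..<k}" for j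
        using L d that atLeastLessThan_iff by blast
      show "E (p i j)" if "i \<in> {1..<d}" "j \<in> {0..<k}" for i j
        using L that atLeastLessThan_iff by blast
    qed
  next
    fix i j
    assume R: "E (p 0 0) \<and> (\<forall>j\<in>{1..<k}. E (p 0 j)) \<and> (\<forall>i\<in>{1..<d}. \<forall>j\<in>{0..<k}. E (p i j))"
      and "i < d" "j < k"
    then show "E (p i j)"
      by (cases "i = 0"; cases "j = 0") simp_all
  qed
  have bin: "(\<forall>i<d. \<forall>j<k. digit_mat n r \<gamma> $$ (i, j mod k) \<in> {0, 1}) \<longleftrightarrow>
      (\<forall>i<d. \<forall>j<k. cyc n \<gamma> (p i j) \<in> {0, 1})"
    by (simp only: ix cong: imp_cong)
  have ix_ends: "digit_mat n r f $$ (0, j mod k) = cyc n f (p 0 j)"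
    "digit_mat n r f $$ (d - 1, j mod k) = cyc n f (p (d - 1) j)" for f :: "nat \<Rightarrow> int" and j
    using d by (simp_all add: ix)
  have row0: "(\<forall>j\<in>{1..<k}. 2 * cyc n \<gamma> (p 0 j) - cyc n \<gamma> (p (d - 1) (j + e)) =
      cyc n \<alpha> (p 0 (j + 1)) + cyc n \<alpha> (p 0 j)) \<longleftrightarrow> (\<forall>j\<in>{1..<k}. E (p 0 j))"
    by (intro ball_cong refl) (simp only: E0)
  have rows: "(\<forall>i\<in>{1..<d}. \<forall>j\<in>{0..<k}. 2 * digit_mat n r \<gamma> $$ (i, j mod k) -
      digit_mat n r \<gamma> $$ (i - 1, j mod k) =
      digit_mat n r \<alpha> $$ (i, (j + 1) mod k) + digit_mat n r \<alpha> $$ (i, j mod k)) \<longleftrightarrow>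
    (\<forall>i\<in>{1..<d}. \<forall>j\<in>{0..<k}. E (p i j))"
  proof (intro ball_cong refl)
    fix i j assume ij: "i \<in> {1..<d}" "j \<in> {0..<k}"
    then have "i < d" "i - 1 < d" by auto
    then show "(2 * digit_mat n r \<gamma> $$ (i, j mod k) - digit_mat n r \<gamma> $$ (i - 1, j mod k) =
      digit_mat n r \<alpha> $$ (i, (j + 1) mod k) + digit_mat n r \<alpha> $$ (i, j mod k)) = E (p i j)"
      by (simp only: ix E1[OF ij])
  qed
  have "?L \<longleftrightarrow> (\<forall>i<d. \<forall>j<k. cyc n \<gamma> (p i j) \<in> {0, 1}) \<and>
    E (p 0 0) \<and> (\<forall>j\<in>{1..<k}. E (p 0 j)) \<and> (\<forall>i\<in>{1..<d}. \<forall>j\<in>{0..<k}. E (p i j))"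
    unfolding carry_mat_def Let_def d_def[symmetric] k_def[symmetric] e_def[symmetric]
      bin rows ix_ends E00 row0
    using carrier by simp
  also have "\<dots> \<longleftrightarrow> ?R"
    unfolding cyclic_carry_def E_def[symmetric] by (simp only: all_conj_distrib bin_iff E_iff split)
  finally show ?thesis .
qed

section \<open>Rotation of digits as multiplication by powers of two\<close>

text \<open>Doubling moves every digit up one place; the top digit reaches weight
  \<open>2 ^ n\<close> but re-enters the rotation with weight 1, which accounts for the
  correction.\<close>

lemma sum_cyc_shift_one:
  fixes f :: "nat \<Rightarrow> int"
  assumes "0 < n"
  shows "(\<Sum>m<n. cyc n f (int m - s - 1) * 2 ^ m) =
    2 * (\<Sum>m<n. cyc n f (int m - s) * 2 ^ m) - cyc n f (- s - 1) * (2 ^ n - 1)"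
proof -
  obtain q where n: "n = Suc q"
    using assms by (cases n) auto
  \<comment> \<open>This is the top digit before the rotation and the lowest digit after it.\<close>
  have "cyc n f (int q - s) = cyc n f (- s - 1)"
    by (rule cyc_cong) (simp add: n cong_iff_dvd_diff add.commute)
  moreover have "(\<Sum>m<n. cyc n f (int m - s - 1) * 2 ^ m) =
      cyc n f (- s - 1) + 2 * (\<Sum>m<q. cyc n f (int m - s) * 2 ^ m)"
    unfolding n sum.lessThan_Suc_shift by (simp add: sum_distrib_left mult_ac)
  moreover have "(\<Sum>m<n. cyc n f (int m - s) * 2 ^ m) =
      (\<Sum>m<q. cyc n f (int m - s) * 2 ^ m) + cyc n f (int q - s) * 2 ^ q"
    unfolding n by simp
  ultimately show ?thesis
    by (simp add: n algebra_simps)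
qed

lemma sum_cyc_shift:
  fixes f :: "nat \<Rightarrow> int"
  assumes "0 < n"
  shows "[(\<Sum>m<n. cyc n f (int m - int r) * 2 ^ m) = 2 ^ r * (\<Sum>m<n. f m * 2 ^ m)] (mod (2 ^ n - 1))"
proof (induction r)
  case 0
  then show ?case
    by (simp add: cyc_of_nat)
next
  case (Suc r)
  have "[(\<Sum>m<n. cyc n f (int m - int r - 1) * 2 ^ m) =
      2 * (\<Sum>m<n. cyc n f (int m - int r) * 2 ^ m)] (mod (2 ^ n - 1))"
    unfolding sum_cyc_shift_one[OF assms] by (simp add: cong_iff_dvd_diff)
  also have "[2 * (\<Sum>m<n. cyc n f (int m - int r) * 2 ^ m) =
      2 * (2 ^ r * (\<Sum>m<n. f m * 2 ^ m))] (mod (2 ^ n - 1))"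
    by (intro cong_mult cong_refl Suc.IH)
  finally show ?case
    by (simp add: algebra_simps)
qed

lemma sum_rotation_cong:
  fixes f :: "nat \<Rightarrow> int"
  assumes "0 < n"
  shows "[(\<Sum>m<n. (cyc n f (int m - int r) + cyc n f (int m)) * 2 ^ m) =
    (\<Sum>m<n. f m * 2 ^ m) * G r] (mod (2 ^ n - 1))"
proof -
  have "(\<Sum>m<n. (cyc n f (int m - int r) + cyc n f (int m)) * 2 ^ m) =
      (\<Sum>m<n. cyc n f (int m - int r) * 2 ^ m) + (\<Sum>m<n. f m * 2 ^ m)"
    by (simp add: distrib_right sum.distrib cyc_of_nat)
  also have "[\<dots> = 2 ^ r * (\<Sum>m<n. f m * 2 ^ m) + (\<Sum>m<n. f m * 2 ^ m)] (mod (2 ^ n - 1))"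
    by (intro cong_add cong_refl sum_cyc_shift assms)
  finally show ?thesis
    by (simp add: G_def algebra_simps)
qed

text \<open>Weight the equation at \<open>m\<close> by \<open>2 ^ m\<close> and sum. The incoming
  carries form a rotation of the outgoing ones, so their sum cancels the doubled sum modulo
  \<open>2 ^ n - 1\<close>, and only 1 remains.\<close>

lemma cyclic_carry_imp_inverse:
  assumes "0 < n" "cyclic_carry n r \<alpha> \<gamma>"
  shows "[(\<Sum>m<n. \<alpha> m * 2 ^ m) * G r = 1] (mod (2 ^ n - 1))"
proof -
  \<comment> \<open>The redundant \<open>- 0\<close> gives the carry sum the form of
    \<open>sum_cyc_shift_one\<close> with \<open>s = 0\<close>.\<close>
  have "(\<Sum>m<n. (cyc n \<alpha> (int m - int r) + cyc n \<alpha> (int m)) * 2 ^ m) =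
      (\<Sum>m<n. 2 * (cyc n \<gamma> (int m) * 2 ^ m) - cyc n \<gamma> (int m - 0 - 1) * 2 ^ m +
        (if m = 0 then 1 else 0))"
  proof (rule sum.cong)
    fix m assume "m \<in> {..<n}"
    then have "int n dvd int m \<longleftrightarrow> m = 0"
      by (auto dest: dvd_imp_le)
    then have *: "cyc n \<alpha> (int m - int r) + cyc n \<alpha> (int m) =
        2 * cyc n \<gamma> (int m) - cyc n \<gamma> (int m - 1) + (if m = 0 then 1 else 0)"
      using spec[OF assms(2)[unfolded cyclic_carry_def], of "int m"] by presburger
    show "(cyc n \<alpha> (int m - int r) + cyc n \<alpha> (int m)) * 2 ^ m =
        2 * (cyc n \<gamma> (int m) * 2 ^ m) - cyc n \<gamma> (int m - 0 - 1) * 2 ^ m + (if m = 0 then 1 else 0)"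
      unfolding * by (simp add: algebra_simps)
  qed simp
  also have "\<dots> = 2 * (\<Sum>m<n. cyc n \<gamma> (int m - 0) * 2 ^ m) -
      (\<Sum>m<n. cyc n \<gamma> (int m - 0 - 1) * 2 ^ m) + 1"
    using assms(1) by (simp add: sum.distrib sum_subtractf sum_distrib_left)
  also have "\<dots> = 1 + cyc n \<gamma> (- 0 - 1) * (2 ^ n - 1)"
    unfolding sum_cyc_shift_one[OF assms(1)] by simp
  finally have "[(\<Sum>m<n. (cyc n \<alpha> (int m - int r) + cyc n \<alpha> (int m)) * 2 ^ m) = 1] (mod (2 ^ n - 1))"
    by (simp add: cong_iff_dvd_diff)
  then show ?thesis
    using cong_trans[OF cong_sym[OF sum_rotation_cong[OF assms(1)]]] by blast
qed

section \<open>Carries of a sum equal to \<open>2 ^ n\<close>\<close>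

lemma sum_digits_le:
  fixes f :: "nat \<Rightarrow> int"
  assumes "\<And>m. m < n \<Longrightarrow> f m \<le> c"
  shows "(\<Sum>m<n. f m * 2 ^ m) \<le> c * (2 ^ n - 1)"
  using assms
proof (induction n)
  case (Suc n)
  have "f n * 2 ^ n \<le> c * 2 ^ n"
    using Suc.prems by (intro mult_right_mono) auto
  moreover have "(\<Sum>m<n. f m * 2 ^ m) \<le> c * (2 ^ n - 1)"
    using Suc by simp
  moreover have "c * (2 ^ Suc n - 1) = c * (2 ^ n - 1) + c * 2 ^ n"
    by (simp add: algebra_simps)
  ultimately show ?case
    unfolding sum.lessThan_Suc by linarith
qed simp

text \<open>\<open>t m\<close> is the carry into position \<open>m\<close>, namely the partial sum
  below \<open>m\<close> divided by \<open>2 ^ m\<close>. The division is exact because both the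
  total \<open>2 ^ n\<close> and the terms from \<open>m\<close> on are divisible by
  \<open>2 ^ m\<close>.\<close>

lemma power2_carries:
  fixes s :: "nat \<Rightarrow> int"
  assumes "\<And>m. m < n \<Longrightarrow> s m \<in> {0..2}" "(\<Sum>m<n. s m * 2 ^ m) = 2 ^ n"
  obtains t where "t 0 = 0" "t n = 1" "\<And>m. m \<le> n \<Longrightarrow> t m \<in> {0, 1}"
    "\<And>m. m < n \<Longrightarrow> 2 * t (Suc m) = t m + s m"
proof -
  define T where "T m = (\<Sum>i<m. s i * 2 ^ i)" for m
  define t where "t m = T m div 2 ^ m" for m
  have dvd: "2 ^ m dvd T m" if "m \<le> n" for m
  proof -
    have "T n = T m + (\<Sum>i\<in>{m..<n}. s i * 2 ^ i)"
      unfolding T_def using that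
      by (metis atLeast0LessThan le0 sum.atLeastLessThan_concat)
    moreover have "2 ^ m dvd (\<Sum>i\<in>{m..<n}. s i * 2 ^ i)"
      by (intro dvd_sum dvd_mult le_imp_power_dvd) simp
    moreover have "2 ^ m dvd T n"
      using assms(2) that by (simp add: T_def le_imp_power_dvd)
    ultimately show ?thesis
      by (metis dvd_add_left_iff)
  qed
  have T: "T m = t m * 2 ^ m" if "m \<le> n" for m
    using dvd[OF that] by (simp add: t_def)
  have step: "2 * t (Suc m) = t m + s m" if "m < n" for m
  proof -
    have "T (Suc m) = T m + s m * 2 ^ m"
      by (simp add: T_def)
    then have "(2 * t (Suc m)) * 2 ^ m = (t m + s m) * 2 ^ m"
      using T[of m] T[of "Suc m"] that by (simp add: algebra_simps)
    then show ?thesis by simp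
  qed
  have t0: "t 0 = 0" by (simp add: t_def T_def)
  have "t m \<in> {0, 1}" if "m \<le> n" for m
    using that
  proof (induction m)
    case (Suc m)
    \<comment> \<open>\<open>t m + s m\<close> is even and lies between 0 and 3, so its half is 0 or
      1.\<close>
    then show ?case
      using step[of m] assms(1)[of m] by auto
  qed (simp add: t0)
  moreover have "t n = 1"
    using assms(2) by (simp add: t_def T_def)
  ultimately show ?thesis
    using that t0 step by blast
qed

lemma inverse_imp_cyclic_carry:
  assumes "0 < n" "(\<Sum>m<n. \<alpha> m * 2 ^ m) \<in> {1..2 ^ n - 2}"
    and bin: "\<And>m. m < n \<Longrightarrow> \<alpha> m \<in> {0, 1}"
    and inv: "[(\<Sum>m<n. \<alpha> m * 2 ^ m) * G r = 1] (mod (2 ^ n - 1))"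
  shows "\<exists>\<gamma>. cyclic_carry n r \<alpha> \<gamma>"
proof -
  let ?a = "\<Sum>m<n. \<alpha> m * 2 ^ m"
  define N :: int where "N = 2 ^ n - 1"
  define s where "s m = cyc n \<alpha> (int m - int r) + cyc n \<alpha> (int m)" for m
  define b where "b = (\<Sum>m<n. cyc n \<alpha> (int m - int r) * 2 ^ m)"
  have bin': "cyc n \<alpha> x \<in> {0, 1}" for x
    using assms(1) bin by (rule cyc_in)
  then have pos: "0 \<le> cyc n \<alpha> x" and le1: "cyc n \<alpha> x \<le> 1" for x
    by (metis insert_iff singletonD zero_le_one order_refl)+
  have S: "(\<Sum>m<n. s m * 2 ^ m) = b + ?a"
    by (simp add: s_def b_def distrib_right sum.distrib cyc_of_nat)
  have "b \<le> N"
    using sum_digits_le[of n "\<lambda>m. cyc n \<alpha> (int m - int r)" 1] le1 by (simp add: b_def N_def)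
  moreover have "0 < b"
  proof -
    have "0 \<le> b"
      unfolding b_def by (intro sum_nonneg) (simp add: pos)
    moreover have "b \<noteq> 0"
    proof
      assume "b = 0"
      then have z: "cyc n \<alpha> (int m - int r) = 0" if "m < n" for m
        using that unfolding b_def by (subst (asm) sum_nonneg_eq_0_iff) (auto simp: pos)
      have "\<alpha> m = 0" if "m < n" for m
      proof -
        \<comment> \<open>Position \<open>q\<close> of the rotated sequence holds the digit
          \<open>\<alpha> m\<close>; if all rotated digits vanish, so do the original ones.\<close>
        define q where "q = nat ((int m + int r) mod int n)"
        have "q < n"
          using assms(1) by (simp add: q_def nat_less_iff)
        moreover have "[int q - int r = int m] (mod int n)"
          using assms(1) by (simp add: q_def cong_def mod_diff_left_eq)
        ultimately show ?thesis
          using z[of q] cyc_cong[of "int q - int r" "int m" n \<alpha>] that by (simp add: cyc_of_nat)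
      qed
      then show False
        using assms(2) by simp
    qed
    ultimately show ?thesis by simp
  qed
  moreover have "1 \<le> ?a" "?a < N"
    using assms(2) by (simp_all add: N_def)
  moreover have "[b + ?a = 1] (mod N)"
    using cong_trans[OF sum_rotation_cong[OF assms(1), of \<alpha> r] inv] S by (simp add: N_def s_def)
  then obtain q where "b + ?a - 1 = N * q"
    unfolding cong_iff_dvd_diff by (rule dvdE)
  then have q: "b + ?a = 1 + N * q"
    by simp
  \<comment> \<open>From \<open>1 \<le> b \<le> N\<close> and \<open>1 \<le> ?a < N\<close>, the
    multiple \<open>b + ?a - 1\<close> of \<open>N\<close> lies strictly between 0 and
    \<open>2 * N\<close>, so it is \<open>N\<close> and the digit sums add up to
    \<open>2 ^ n\<close>.\<close>
  ultimately have "0 < N * q" "N * q < N * 2" "0 < N"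
    by linarith+
  then have "q = 1"
    by (simp add: zero_less_mult_iff)
  then have "(\<Sum>m<n. s m * 2 ^ m) = 2 ^ n"
    using q S by (simp add: N_def)
  moreover have "s m \<in> {0..2}" for m
    using pos[of "int m - int r"] le1[of "int m - int r"] pos[of "int m"] le1[of "int m"]
    by (simp add: s_def)
  ultimately obtain t where t: "t 0 = 0" "t n = 1" "\<And>m. m \<le> n \<Longrightarrow> t m \<in> {0, 1}"
    "\<And>m. m < n \<Longrightarrow> 2 * t (Suc m) = t m + s m"
    using power2_carries by blast
  \<comment> \<open>The index shift passes from carries into a position to carries out of
    it.\<close>
  define \<gamma> where "\<gamma> m = t (Suc m)" for m
  have "cyclic_carry n r \<alpha> \<gamma>"
    unfolding cyclic_carry_def
  proof
    fix x
    define m where "m = nat (x mod int n)"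
    have m: "m < n" and im: "int m = x mod int n"
      using assms(1) by (simp_all add: m_def nat_less_iff)
    have c: "[x = int m] (mod int n)"
      by (simp add: im cong_def)
    have "cyc n \<gamma> x = t (Suc m)"
      using cyc_cong[OF c, of \<gamma>] m by (simp add: cyc_of_nat \<gamma>_def)
    \<comment> \<open>Around the cycle, position 0 receives the final carry \<open>t n = 1\<close>
      instead of \<open>t 0 = 0\<close>; the extra 1 in the equation there compensates for
      this.\<close>
    moreover have "cyc n \<gamma> (x - 1) = (if m = 0 then 1 else t m)"
    proof (cases "m = 0")
      case True
      have "[x - 1 = int m - 1 + int n] (mod int n)"
        using cong_diff[OF c cong_refl, of 1] by (simp add: cong_def)
      then have "[x - 1 = int (n - 1)] (mod int n)"
        using True assms(1) by (simp add: of_nat_diff)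
      then have "cyc n \<gamma> (x - 1) = cyc n \<gamma> (int (n - 1))"
        by (rule cyc_cong)
      with True t(2) assms(1) show ?thesis
        by (simp only: cyc_of_nat diff_less zero_less_one) (simp add: \<gamma>_def)
    next
      case False
      then have "[x - 1 = int (m - 1)] (mod int n)"
        using cong_diff[OF c cong_refl, of 1] by (simp add: of_nat_diff)
      then have "cyc n \<gamma> (x - 1) = cyc n \<gamma> (int (m - 1))"
        by (rule cyc_cong)
      with False m show ?thesis
        by (simp only: cyc_of_nat less_imp_diff_less) (simp add: \<gamma>_def)
    qed
    moreover have "cyc n \<alpha> (x - int r) + cyc n \<alpha> x = s m"
      using cyc_cong[OF c, of \<alpha>] cyc_cong[OF cong_diff[OF c cong_refl], of \<alpha>] by (simp add: s_def)
    moreover have "int n dvd x \<longleftrightarrow> m = 0"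
      using im by (auto simp: dvd_eq_mod_eq_0)
    ultimately show "cyc n \<gamma> x \<in> {0, 1} \<and>
      2 * cyc n \<gamma> x - cyc n \<gamma> (x - 1) + (if int n dvd x then 1 else 0) = cyc n \<alpha> (x - int r) + cyc n \<alpha> x"
      using t(1) t(3)[of "Suc m"] t(4)[OF m] m by simp
  qed
  then show ?thesis by blast
qed

section \<open>Uniqueness and assembly\<close>

lemma cyclic_carry_unique:
  assumes "cyclic_carry n r \<alpha> \<gamma>" "cyclic_carry n r \<alpha> \<gamma>'"
  shows "cyc n \<gamma> x = cyc n \<gamma>' x"
proof -
  \<comment> \<open>The equations at \<open>x + 1\<close> share their right-hand side, so the two
    values at \<open>x\<close> differ by an even number; being 0 or 1, they agree.\<close>
  have eq: "2 * cyc n \<gamma> (x + 1) - cyc n \<gamma> x = 2 * cyc n \<gamma>' (x + 1) - cyc n \<gamma>' x"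
    using assms unfolding cyclic_carry_def by (metis add_diff_cancel_right')
  have "cyc n \<gamma> x \<in> {0, 1}" "cyc n \<gamma>' x \<in> {0, 1}"
    using assms unfolding cyclic_carry_def by blast+
  then show ?thesis
    using eq by auto presburger+
qed

theorem theorem4:
  fixes n r :: nat and a :: int and \<alpha> :: "nat \<Rightarrow> int"
  assumes "0 < n" and "0 < r"
    and "a \<in> {1..2 ^ n - 2}"
    and "\<And>m. m < n \<Longrightarrow> \<alpha> m \<in> {0, 1}"
    and "a = (\<Sum>m<n. \<alpha> m * 2 ^ m)"
  shows "[a = (\<Sum>i<gcd r n. \<Sum>j<n div gcd r n.
            digit_mat n r \<alpha> $$ (i, j) * pow2 n (int i - int j * int r))] (mod (2 ^ n - 1))
    \<and> ([a * G r = 1] (mod (2 ^ n - 1)) \<longleftrightarrow> (\<exists>C. carry_mat n r (digit_mat n r \<alpha>) C))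
    \<and> (\<forall>C C'. carry_mat n r (digit_mat n r \<alpha>) C \<longrightarrow> carry_mat n r (digit_mat n r \<alpha>) C' \<longrightarrow> C = C')"
proof (intro conjI allI impI)
  let ?d = "gcd r n" and ?k = "n div gcd r n"
  have "(\<Sum>i<?d. \<Sum>j<?k. digit_mat n r \<alpha> $$ (i, j) * pow2 n (int i - int j * int r)) =
      (\<Sum>(i, j)\<in>{..<?d} \<times> {..<?k}. digit_mat n r \<alpha> $$ (i, j) * pow2 n (int i - int j * int r))"
    by (simp add: sum.cartesian_product)
  \<comment> \<open>Since \<open>pow2\<close> reduces its exponent modulo \<open>n\<close>, the
    double sum is a reindexing of the binary expansion, and even equality holds.\<close>
  also have "\<dots> = (\<Sum>p\<in>{..<?d} \<times> {..<?k}. (\<lambda>m. \<alpha> m * 2 ^ m)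
      ((\<lambda>(i, j). nat ((int i - int j * int r) mod int n)) p))"
    by (intro sum.cong) (auto simp: digit_mat_def pow2_def)
  also have "\<dots> = (\<Sum>m<n. \<alpha> m * 2 ^ m)"
    by (rule sum.reindex_bij_betw[OF bij_betw_index[OF assms(1,2)]])
  finally show "[a = (\<Sum>i<?d. \<Sum>j<?k. digit_mat n r \<alpha> $$ (i, j) * pow2 n (int i - int j * int r))]
      (mod (2 ^ n - 1))"
    using assms(5) by simp
next
  have carrier: "C \<in> carrier_mat (gcd r n) (n div gcd r n)" if "carry_mat n r (digit_mat n r \<alpha>) C" for C
    using that by (simp add: carry_mat_def Let_def)
  show "[a * G r = 1] (mod (2 ^ n - 1)) \<longleftrightarrow> (\<exists>C. carry_mat n r (digit_mat n r \<alpha>) C)"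
  proof
    assume "[a * G r = 1] (mod (2 ^ n - 1))"
    then have "\<exists>\<gamma>. cyclic_carry n r \<alpha> \<gamma>"
      using assms(3,4) inverse_imp_cyclic_carry[OF assms(1)] unfolding assms(5) by blast
    then show "\<exists>C. carry_mat n r (digit_mat n r \<alpha>) C"
      using carry_mat_iff[OF assms(1,2)] by blast
  next
    assume "\<exists>C. carry_mat n r (digit_mat n r \<alpha>) C"
    then obtain \<gamma> where "carry_mat n r (digit_mat n r \<alpha>) (digit_mat n r \<gamma>)"
      using carrier ex_digit_mat[OF assms(1,2)] by metis
    then show "[a * G r = 1] (mod (2 ^ n - 1))"
      using carry_mat_iff[OF assms(1,2)] cyclic_carry_imp_inverse[OF assms(1)] unfolding assms(5) by blast
  qed
  fix C C'
  assume C: "carry_mat n r (digit_mat n r \<alpha>) C" and C': "carry_mat n r (digit_mat n r \<alpha>) C'"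
  obtain \<gamma> where \<gamma>: "C = digit_mat n r \<gamma>"
    using ex_digit_mat[OF assms(1,2) carrier[OF C]] .
  obtain \<gamma>' where \<gamma>': "C' = digit_mat n r \<gamma>'"
    using ex_digit_mat[OF assms(1,2) carrier[OF C']] .
  \<comment> \<open>Agreement of the periodic extensions is enough: \<open>\<gamma>\<close> and
    \<open>\<gamma>'\<close> may differ from \<open>n\<close> on, where the matrices do not read
    them.\<close>
  have "cyc n \<gamma> x = cyc n \<gamma>' x" for x
    using C C' carry_mat_iff[OF assms(1,2)] cyclic_carry_unique unfolding \<gamma> \<gamma>' by blast
  then show "C = C'"
    unfolding \<gamma> \<gamma>' digit_mat_def cyc_def by simp
qed

end
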